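(* Let $k \geq 3$ and let $H$ be a finite $k$-uniform hypergraph with $\nu^{(k-1)}(H) = 2$. Then $$\tau^{(k-1)}(H) \leq 2\left\lceil \frac{k+1}{2} \right\rceil.$$
   Context: For a $k$-uniform hypergraph $H$ with vertex set $V$ and $1 \le m \le k-1$: an $m$-matching of $H$ is a set $M$ of edges of $H$ such that $|e \cap e'| < m$ for all distinct $e, e' \in M$; $\nu^{(m)}(H)$ is the maximum size of an $m$-matching. An $m$-cover of $H$ is a set $C \subseteq \binom{V}{m}$ of $m$-subsets of $V$ such that every edge of $H$ contains some member of $C$; $\tau^{(m)}(H)$ is the minimum size of an $m$-cover. *)

theory Defs
  imports Complex_Main "HOL-Library.Ramsey"
begin

text \<open>
  A hypergraph is given by its vertex set \<open>V\<close> and its edge set \<open>E\<close> (no repeated edges).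
  The library's \<open>nsets V k\<close> is the set of all \<open>k\<close>-element subsets of \<open>V\<close>.
\<close>

definition finite_uniform_hypergraph :: "nat \<Rightarrow> 'a set \<Rightarrow> 'a set set \<Rightarrow> bool" where
  "finite_uniform_hypergraph k V E \<longleftrightarrow> finite V \<and> E \<subseteq> nsets V k"

definition is_matching :: "nat \<Rightarrow> 'a set set \<Rightarrow> 'a set set \<Rightarrow> bool" where
  "is_matching m E M \<longleftrightarrow> M \<subseteq> E \<and> pairwise (\<lambda>e e'. card (e \<inter> e') < m) M"

definition is_cover :: "nat \<Rightarrow> 'a set \<Rightarrow> 'a set set \<Rightarrow> 'a set set \<Rightarrow> bool" where
  "is_cover m V E C \<longleftrightarrow> C \<subseteq> nsets V m \<and> (\<forall>e\<in>E. \<exists>c\<in>C. c \<subseteq> e)"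

definition matching_number :: "nat \<Rightarrow> 'a set set \<Rightarrow> nat" where
  "matching_number m E = Max {card M | M. is_matching m E M}"

definition cover_number :: "nat \<Rightarrow> 'a set \<Rightarrow> 'a set set \<Rightarrow> nat" where
  "cover_number m V E = Min {card C | C. is_cover m V E C}"

text \<open>
  The maximum and the minimum above range over finite nonempty sets, so they are attained.
\<close>

lemma finite_nsets: "finite V \<Longrightarrow> finite (nsets V k)"
  by (rule finite_subset[of _ "Pow V"]) (auto simp: nsets_def)

lemma matching_number_attained:
  assumes "finite_uniform_hypergraph k V E"
  shows "finite {card M | M. is_matching m E M}" "{card M | M. is_matching m E M} \<noteq> {}"
proof -
  have "finite E"
    using assms finite_nsets finite_subset unfolding finite_uniform_hypergraph_def by metis
  then have "finite (card ` Pow E)" by simp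
  then show "finite {card M | M. is_matching m E M}"
    by (rule finite_subset[rotated]) (auto simp: is_matching_def)
  have "is_matching m E {}" by (simp add: is_matching_def)
  then show "{card M | M. is_matching m E M} \<noteq> {}" by blast
qed

lemma cover_number_attained:
  assumes "finite_uniform_hypergraph k V E" "m \<le> k"
  shows "finite {card C | C. is_cover m V E C}" "{card C | C. is_cover m V E C} \<noteq> {}"
proof -
  have "finite (card ` Pow (nsets V m))"
    using assms finite_nsets unfolding finite_uniform_hypergraph_def by blast
  then show "finite {card C | C. is_cover m V E C}"
    by (rule finite_subset[rotated]) (auto simp: is_cover_def)
  have "\<exists>c\<in>nsets V m. c \<subseteq> e" if "e \<in> E" for e
  proof -
    have e: "e \<subseteq> V" "finite e" "card e = k"
      using that assms(1) by (auto simp: finite_uniform_hypergraph_def nsets_def)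
    then obtain c where "c \<subseteq> e" "card c = m" "finite c"
      using assms(2) obtain_subset_with_card_n[of m e] by metis
    then show ?thesis using e by (auto simp: nsets_def)
  qed
  then have "is_cover m V E (nsets V m)" by (simp add: is_cover_def)
  then show "{card C | C. is_cover m V E C} \<noteq> {}" by blast
qed

end

theory Submission
  imports Defs
begin

text \<open>
  Call two \<open>k\<close>-sets adjacent if they share at least \<open>k - 1\<close> elements. A pairwise adjacent family
  either has a common \<open>(k - 1)\<close>-subset (a star) or lies inside a \<open>(k + 1)\<close>-set (a top); a top is
  covered by \<open>q = \<lceil>(k + 1) / 2\<rceil>\<close> sets, each missing two points of the \<open>(k + 1)\<close>-set.
  Fix non-adjacent edges \<open>A\<close>, \<open>B\<close>. Every edge is adjacent to one of them, and the edges adjacent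
  to \<open>A\<close> but not to \<open>B\<close> are pairwise adjacent, since two non-adjacent ones would form a
  matching of size 3 with \<open>B\<close>. Hence \<open>2 q\<close> sets suffice unless there are edges \<open>Z\<close> adjacent to both,
  which forces \<open>|A - B| = 2\<close>; these are covered by the two sets \<open>A - {a}\<close>, \<open>a \<in> A - B\<close>. If the private edges
  of \<open>A\<close> all contain \<open>A \<inter> B\<close>, the same two sets cover them as well, for a total of \<open>2 + q\<close>.
  If both private families are stars, \<open>1 + 1 + 2\<close> sets suffice. Otherwise, non-adjacent
  private edges \<open>A - {a} + x\<close> and \<open>B - {b} + y\<close> with \<open>a, b \<in> A \<inter> B\<close> force \<open>x \<in> Z\<close> or \<open>y \<in> Z\<close>, so that
  the common neighbours are absorbed by the tops.
\<close>

section \<open>Adjacency of sets of equal size\<close>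

text \<open>Encodes |e - f| \<le> 1 pointwise. For finite sets of equal size k \<ge> 1 it is
  symmetric and means |e \<inter> f| \<ge> k - 1, so a (k - 1)-matching is a family of pairwise
  non-adjacent edges.\<close>

definition adj :: "'a set \<Rightarrow> 'a set \<Rightarrow> bool" where
  "adj e f \<longleftrightarrow> (\<forall>u\<in>e - f. \<forall>v\<in>e - f. u = v)"

lemma adj_refl [simp]: "adj e e"
  by (simp add: adj_def)

lemma not_adjI: "u \<in> e \<Longrightarrow> u \<notin> f \<Longrightarrow> v \<in> e \<Longrightarrow> v \<notin> f \<Longrightarrow> u \<noteq> v \<Longrightarrow> \<not> adj e f"
  by (auto simp: adj_def)

lemma adjD: "adj e f \<Longrightarrow> u \<in> e \<Longrightarrow> u \<notin> f \<Longrightarrow> v \<in> e \<Longrightarrow> v \<notin> f \<Longrightarrow> u = v"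
  by (auto simp: adj_def)

lemma adj_iff_card_diff: "finite e \<Longrightarrow> adj e f \<longleftrightarrow> card (e - f) \<le> 1"
  by (simp add: adj_def card_le_Suc0_iff_eq)

lemma card_diff_commute:
  assumes "finite e" "finite f" "card e = card f"
  shows "card (e - f) = card (f - e)"
  using assms by (metis card_le_sym_Diff dual_order.refl le_antisym)

lemma adj_sym:
  assumes "finite e" "finite f" "card e = card f"
  shows "adj e f \<longleftrightarrow> adj f e"
  using assms by (simp add: adj_iff_card_diff card_diff_commute)

lemma not_adj_iff_card_Int:
  assumes "finite e" "card e = k" "k \<ge> 1"
  shows "\<not> adj e f \<longleftrightarrow> card (e \<inter> f) < k - 1"
proof -
  have "card (e \<inter> f) + card (e - f) = k"
    using assms by (metis card_Int_Diff)
  then show ?thesis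
    using assms by (auto simp: adj_iff_card_diff)
qed

lemma adj_exchange:
  assumes "finite e" "finite f" "card e = card f" "adj e f" "e \<noteq> f"
  obtains a x where "a \<in> f" "x \<notin> f" "e = insert x (f - {a})"
proof -
  have le: "card (e - f) \<le> 1" "card (f - e) \<le> 1"
    using assms by (simp_all add: adj_iff_card_diff card_diff_commute)
  have "\<not> e \<subseteq> f" "\<not> f \<subseteq> e"
    using assms by (metis card_subset_eq)+
  then obtain x a where xa: "x \<in> e" "x \<notin> f" "a \<in> f" "a \<notin> e"
    by blast
  have "e - f = {x}" "f - e = {a}"
    using le xa assms(1,2) by (auto simp: card_le_Suc0_iff_eq)
  then have "e = insert x (f - {a})"
    by blast
  with xa show thesis
    using that by blast
qed

section \<open>Covering numbers of families\<close>

text \<open>Bounding the size for an arbitrary family, with no ambient vertex set, lets covers of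
  pieces of \<open>E\<close> be added up.\<close>

definition coverable :: "nat \<Rightarrow> nat \<Rightarrow> 'a set set \<Rightarrow> bool" where
  "coverable m n F \<longleftrightarrow>
    (\<exists>C. finite C \<and> card C \<le> n \<and> (\<forall>c\<in>C. finite c \<and> card c = m) \<and> (\<forall>e\<in>F. \<exists>c\<in>C. c \<subseteq> e))"

lemma coverableI:
  assumes "finite C" "card C \<le> n" "\<And>c. c \<in> C \<Longrightarrow> finite c \<and> card c = m"
    "\<And>e. e \<in> F \<Longrightarrow> \<exists>c\<in>C. c \<subseteq> e"
  shows "coverable m n F"
  using assms unfolding coverable_def by blast

lemma coverable_mono: "coverable m n F \<Longrightarrow> n \<le> n' \<Longrightarrow> F' \<subseteq> F \<Longrightarrow> coverable m n' F'"
  unfolding coverable_def by (meson le_trans subsetD)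

lemma coverable_Un:
  assumes "coverable m n F" "coverable m n' F'"
  shows "coverable m (n + n') (F \<union> F')"
proof -
  obtain C where C: "finite C" "card C \<le> n" "\<forall>c\<in>C. finite c \<and> card c = m" "\<forall>e\<in>F. \<exists>c\<in>C. c \<subseteq> e"
    using assms(1) unfolding coverable_def by blast
  obtain D where D: "finite D" "card D \<le> n'" "\<forall>c\<in>D. finite c \<and> card c = m" "\<forall>e\<in>F'. \<exists>c\<in>D. c \<subseteq> e"
    using assms(2) unfolding coverable_def by blast
  show ?thesis
  proof (rule coverableI)
    show "card (C \<union> D) \<le> n + n'"
      using C D card_Un_le[of C D] by linarith
    show "\<exists>c\<in>C \<union> D. c \<subseteq> e" if "e \<in> F \<union> F'" for e
      using that C(4) D(4) by (meson UnCI UnE)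
  qed (use C D in auto)
qed

text \<open>\<open>T - {u, v}\<close> lies in both \<open>T - {u}\<close> and
  \<open>T - {v}\<close>, so the points of \<open>U\<close> are removed in pairs. A last single
  point is paired with any other point of \<open>T\<close>, which accounts for rounding up.\<close>

lemma coverable_top_aux:
  assumes "finite T" "card T \<ge> 2" "U \<subseteq> T"
  shows "coverable (card T - 2) ((card U + 1) div 2) ((\<lambda>u. T - {u}) ` U)"
  using assms(3)
proof (induction "card U" arbitrary: U rule: less_induct)
  case less
  have finU: "finite U"
    using less.prems assms(1) finite_subset by blast
  have pair: "coverable (card T - 2) 1 ((\<lambda>u. T - {u}) ` {u, v})" if "u \<in> T" "v \<in> T" "u \<noteq> v" for u v
  proof (rule coverableI[of "{T - {u, v}}"])
    fix c assume "c \<in> {T - {u, v}}"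
    moreover have "card {u, v} = 2"
      using that by simp
    ultimately show "finite c \<and> card c = card T - 2"
      using that assms(1) by (simp add: card_Diff_subset)
  qed auto
  show ?case
  proof (cases "U = {}")
    case True
    then show ?thesis
      by (auto intro!: coverableI[of "{}"])
  next
    case False
    then obtain u where u: "u \<in> U" by blast
    show ?thesis
    proof (cases "U = {u}")
      case True
      have "\<not> T \<subseteq> {u}"
        using assms(2) card_mono[of "{u}" T] by auto
      then obtain v where "v \<in> T" "v \<noteq> u" by blast
      then show ?thesis
        using pair[of u v] u less.prems True by (auto intro: coverable_mono)
    next
      case False
      then obtain v where v: "v \<in> U" "v \<noteq> u"
        using u by blast
      have "{u, v} \<subseteq> U" "card {u, v} = 2"
        using u v by auto
      then have card: "card U \<ge> 2" "card (U - {u, v}) = card U - 2"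
        using finU by (metis card_mono, metis card_Diff_subset finite_subset)
      have "coverable (card T - 2) ((card (U - {u, v}) + 1) div 2) ((\<lambda>w. T - {w}) ` (U - {u, v}))"
        by (rule less.hyps) (use card less.prems in auto)
      moreover have "coverable (card T - 2) 1 ((\<lambda>w. T - {w}) ` {u, v})"
        by (rule pair) (use u v less.prems in auto)
      ultimately have "coverable (card T - 2) ((card (U - {u, v}) + 1) div 2 + 1)
          ((\<lambda>w. T - {w}) ` (U - {u, v}) \<union> (\<lambda>w. T - {w}) ` {u, v})"
        by (rule coverable_Un)
      then show ?thesis
      proof (rule coverable_mono)
        show "(card (U - {u, v}) + 1) div 2 + 1 \<le> (card U + 1) div 2"
          using card by linarith
        show "(\<lambda>w. T - {w}) ` U \<subseteq> (\<lambda>w. T - {w}) ` (U - {u, v}) \<union> (\<lambda>w. T - {w}) ` {u, v}"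
          by blast
      qed
    qed
  qed
qed

lemma coverable_top:
  assumes "finite T" "card T = Suc k" "k \<ge> 1" "\<And>e. e \<in> F \<Longrightarrow> e \<subseteq> T \<and> card e = k"
  shows "coverable (k - 1) ((k + 2) div 2) F"
proof -
  have "F \<subseteq> (\<lambda>u. T - {u}) ` T"
  proof
    fix e assume "e \<in> F"
    then have e: "e \<subseteq> T" "card e = k" "finite e"
      using assms finite_subset by blast+
    then have "card (T - e) = 1"
      using assms by (simp add: card_Diff_subset)
    then obtain u where "T - e = {u}"
      by (auto simp: card_1_singleton_iff)
    with e show "e \<in> (\<lambda>u. T - {u}) ` T"
      by auto
  qed
  moreover have "coverable (k - 1) ((k + 2) div 2) ((\<lambda>u. T - {u}) ` T)"
    using coverable_top_aux[of T T] assms by simp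
  ultimately show ?thesis
    using coverable_mono by blast
qed

definition star :: "nat \<Rightarrow> 'a set set \<Rightarrow> bool" where
  "star k F \<longleftrightarrow> (\<exists>c. finite c \<and> card c = k - 1 \<and> (\<forall>e\<in>F. c \<subseteq> e))"

lemma coverable_star:
  assumes "star k F"
  shows "coverable (k - 1) 1 F"
proof -
  obtain c where "finite c" "card c = k - 1" "\<forall>e\<in>F. c \<subseteq> e"
    using assms unfolding star_def by blast
  then show ?thesis
    by (intro coverableI[of "{c}"]) auto
qed

text \<open>Adjacent sets \<open>insert x (A - {a})\<close> and \<open>insert y (A - {b})\<close>
  with \<open>a \<noteq> b\<close> must have \<open>x = y\<close>. Without a common core
  \<open>A - {a}\<close>, at least two different points of \<open>A\<close> get removed, which ties
  all the new points together.\<close>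

lemma clique_cases:
  assumes sets: "\<And>e. e \<in> F \<Longrightarrow> finite e \<and> card e = k" and "k \<ge> 1" "A \<in> F"
    and clique: "\<And>e f. e \<in> F \<Longrightarrow> f \<in> F \<Longrightarrow> adj e f"
    and "\<not> star k F"
  obtains x where "x \<notin> A" "\<And>e. e \<in> F \<Longrightarrow> e \<subseteq> insert x A"
proof -
  have sub: "\<exists>e\<in>F. \<not> A - {a} \<subseteq> e" if "a \<in> A" for a
    using assms(5) that sets[OF assms(3)] unfolding star_def
    by (metis card_Diff_singleton finite_Diff)
  have ex: "\<exists>a x. a \<in> A \<and> x \<notin> A \<and> e = insert x (A - {a})" if "e \<in> F" "e \<noteq> A" for e
    using adj_exchange[of e A] sets that clique assms(3) by metis
  have "A \<noteq> {}"
    using sets assms(2,3) by fastforce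
  then obtain a0 where "a0 \<in> A" by blast
  then obtain e1 where "e1 \<in> F" "e1 \<noteq> A"
    using sub by blast
  then obtain a x where e1: "insert x (A - {a}) \<in> F" "a \<in> A" "x \<notin> A"
    using ex by metis
  obtain e2 where "e2 \<in> F" "\<not> A - {a} \<subseteq> e2" "e2 \<noteq> A"
    using sub e1(2) by blast
  then obtain b y where e2: "insert y (A - {b}) \<in> F" "b \<in> A" "y \<notin> A" "b \<noteq> a"
    using ex by (metis subset_insertI)
  have same: "c = d \<or> u = v" if "insert u (A - {c}) \<in> F" "insert v (A - {d}) \<in> F"
      "c \<in> A" "d \<in> A" "u \<notin> A" "v \<notin> A" for c d u v
    using adjD[OF clique[OF that(1,2)], of d u] that by auto
  have "y = x"
    using same e1 e2 by metis
  have "e \<subseteq> insert x A" if e: "e \<in> F" for e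
  proof (cases "e = A")
    case False
    then obtain c z where c: "c \<in> A" "z \<notin> A" "e = insert z (A - {c})"
      using ex e by metis
    \<comment> \<open>\<open>c\<close> differs from at least one of \<open>a\<close> and
      \<open>b\<close>, so \<open>z\<close> is the point added there, and that is \<open>x\<close>
      in both cases.\<close>
    have "z = x"
      using same[of z c x a] same[of z c x b] e c e1 e2 \<open>y = x\<close> by metis
    then show ?thesis using c by auto
  qed auto
  with e1 show thesis using that by blast
qed

section \<open>Two non-adjacent edges in a family without three\<close>

definition priv :: "'a set set \<Rightarrow> 'a set \<Rightarrow> 'a set \<Rightarrow> 'a set set" where
  "priv E A B = {e \<in> E. adj e A \<and> \<not> adj e B}"

definition common :: "'a set set \<Rightarrow> 'a set \<Rightarrow> 'a set \<Rightarrow> 'a set set" where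
  "common E A B = {e \<in> E. adj e A \<and> adj e B}"

lemma common_commute: "common E B A = common E A B"
  by (auto simp: common_def)

text \<open>This is matching number 2 in terms of adjacency: \<open>A\<close>, \<open>B\<close> form
  a matching and \<open>no_three\<close> forbids a larger one, since by reflexivity of
  \<open>adj\<close> three pairwise non-adjacent edges are distinct. The setting is symmetric in
  \<open>A\<close> and \<open>B\<close>.\<close>

locale independent_pair =
  fixes k :: nat and E :: "'a set set" and A B :: "'a set"
  assumes k: "k \<ge> 3"
    and sets: "e \<in> E \<Longrightarrow> finite e \<and> card e = k"
    and A: "A \<in> E" and B: "B \<in> E" and nadj: "\<not> adj A B"
    and no_three: "e \<in> E \<Longrightarrow> f \<in> E \<Longrightarrow> g \<in> E \<Longrightarrow> adj e f \<or> adj e g \<or> adj f g"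
begin

lemma adj_commute: "e \<in> E \<Longrightarrow> f \<in> E \<Longrightarrow> adj e f \<longleftrightarrow> adj f e"
  using adj_sym sets by metis

lemma swap: "independent_pair k E B A"
  using k sets A B nadj no_three adj_commute by unfold_locales blast+

lemma E_split: "E = priv E A B \<union> priv E B A \<union> common E A B"
  unfolding priv_def common_def using no_three A B nadj adj_commute by blast

lemma A_in_priv: "A \<in> priv E A B"
  unfolding priv_def using A nadj by simp

lemma priv_clique: "e \<in> priv E A B \<Longrightarrow> f \<in> priv E A B \<Longrightarrow> adj e f"
  unfolding priv_def using no_three B adj_commute by blast

lemma exchange_A:
  assumes "e \<in> E" "adj e A" "e \<noteq> A"
  obtains a x where "a \<in> A" "x \<notin> A" "e = insert x (A - {a})"
  using adj_exchange[of e A] sets A assms by metis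

lemma priv_top:
  assumes "\<not> star k (priv E A B)"
  obtains x where "x \<notin> A" "\<And>e. e \<in> priv E A B \<Longrightarrow> e \<subseteq> insert x A"
proof (rule clique_cases[of "priv E A B" k A])
  show "finite e \<and> card e = k" if "e \<in> priv E A B" for e
    using that sets unfolding priv_def by blast
qed (use k A_in_priv priv_clique assms that in auto)

lemma coverable_top_A:
  assumes "F \<subseteq> E" "x \<notin> A" "\<And>e. e \<in> F \<Longrightarrow> e \<subseteq> insert x A"
  shows "coverable (k - 1) ((k + 2) div 2) F"
  using assms sets A k by (intro coverable_top[of "insert x A"]) auto

lemma coverable_priv: "coverable (k - 1) ((k + 2) div 2) (priv E A B)"
proof (cases "star k (priv E A B)")
  case True
  then show ?thesis
    by (rule coverable_mono[OF coverable_star]) (use k in auto)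
next
  case False
  then obtain x where "x \<notin> A" "\<And>e. e \<in> priv E A B \<Longrightarrow> e \<subseteq> insert x A"
    using priv_top by blast
  then show ?thesis
    by (intro coverable_top_A) (auto simp: priv_def)
qed

lemma common_diff:
  assumes "Z \<in> common E A B"
  obtains a a' where "a \<noteq> a'" "A - B = {a, a'}"
proof -
  have Z: "Z \<in> E" "finite Z" "card (Z - B) \<le> 1" "card (A - Z) \<le> 1"
    using assms sets A adj_commute[of Z A] adj_iff_card_diff[of Z B] adj_iff_card_diff[of A Z]
    unfolding common_def by auto
  have finA: "finite A"
    using sets A by blast
  \<comment> \<open>Triangle inequality through \<open>Z\<close>: a point of \<open>A - B\<close>
    either is missing from \<open>Z\<close> or witnesses \<open>Z - B\<close>.\<close>
  have "card (A - B) \<le> card ((A - Z) \<union> (Z - B))"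
    using finA Z by (intro card_mono) auto
  also have "\<dots> \<le> card (A - Z) + card (Z - B)"
    by (rule card_Un_le)
  finally have "card (A - B) \<le> 2"
    using Z by linarith
  moreover have "card (A - B) \<ge> 2"
    using nadj finA by (simp add: adj_iff_card_diff)
  ultimately show thesis
    using that by (metis card_2_iff le_antisym)
qed

text \<open>If \<open>Z\<close> missed a point of \<open>A \<inter> B\<close>, it could miss nothing
  else of \<open>A\<close>, so it would contain both points of \<open>A - B\<close> and not be
  adjacent to \<open>B\<close>.\<close>

lemma common_Int_subset:
  assumes "Z \<in> common E A B"
  shows "A \<inter> B \<subseteq> Z"
proof
  fix s assume s: "s \<in> A \<inter> B"
  obtain a a' where a: "a \<noteq> a'" "A - B = {a, a'}"
    using common_diff assms by blast
  have Z: "adj A Z" "adj Z B"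
    using assms A adj_commute unfolding common_def by blast+
  show "s \<in> Z"
  proof (rule ccontr)
    assume "s \<notin> Z"
    then have "a \<in> Z" "a' \<in> Z"
      using adjD[OF Z(1), of s] s a by blast+
    then show False
      using adjD[OF Z(2), of a a'] a by blast
  qed
qed

text \<open>An edge adjacent to \<open>A\<close> misses at most one of the two points of
  \<open>A - B\<close>; if it contains \<open>A \<inter> B\<close>, it therefore contains
  \<open>A\<close> minus one of them.\<close>

lemma coverable_common_Un:
  assumes "common E A B \<noteq> {}" "F \<subseteq> priv E A B" "\<And>e. e \<in> F \<Longrightarrow> A \<inter> B \<subseteq> e"
  shows "coverable (k - 1) 2 (common E A B \<union> F)"
proof -
  obtain a a' where a: "a \<noteq> a'" "A - B = {a, a'}"
    using common_diff assms by blast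
  show ?thesis
  proof (rule coverableI[of "{A - {a}, A - {a'}}"])
    fix e assume e: "e \<in> common E A B \<union> F"
    then have "adj A e"
      using assms(2) A adj_commute unfolding common_def priv_def by blast
    moreover have "A \<inter> B \<subseteq> e"
      using e assms common_Int_subset by blast
    moreover have "a \<in> e \<or> a' \<in> e"
      using a adjD[OF \<open>adj A e\<close>, of a a'] by blast
    moreover have "w \<in> B \<or> w = a \<or> w = a'" if "w \<in> A" for w
      using that a(2) by (metis Diff_iff empty_iff insert_iff)
    ultimately have "A - {a'} \<subseteq> e \<or> A - {a} \<subseteq> e"
      by auto
    then show "\<exists>c\<in>{A - {a}, A - {a'}}. c \<subseteq> e"
      by blast
  next
    fix c assume "c \<in> {A - {a}, A - {a'}}"
    moreover have "a \<in> A" "a' \<in> A"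
      using a(2) by (metis Diff_iff insertI1 insertI2)+
    ultimately show "finite c \<and> card c = k - 1"
      using sets[OF A] by auto
  qed (simp_all add: card_insert_if)
qed

text \<open>
  By \<open>common_Int_subset\<close>, a common neighbour \<open>Z\<close> can only be adjacent to \<open>insert x (A - {a})\<close>, \<open>a \<in> B\<close>,
  if it contains \<open>x\<close>: otherwise \<open>x\<close> and an element of \<open>A - B\<close> are missing from \<open>Z\<close>.
\<close>
lemma common_adj_exchanged:
  assumes "Z \<in> common E A B" "x \<notin> A" "a \<in> A \<inter> B" "adj (insert x (A - {a})) Z"
  shows "x \<in> Z"
proof (rule ccontr)
  assume x: "x \<notin> Z"
  obtain a1 a2 where a: "a1 \<noteq> a2" "A - B = {a1, a2}"
    using common_diff assms by blast
  have Z: "adj Z B"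
    using assms unfolding common_def by blast
  then obtain c where "c \<in> A - B" "c \<notin> Z"
    using adjD[OF Z, of a1 a2] a by blast
  then show False
    using adjD[OF assms(4), of x c] x assms(2,3) by auto
qed

text \<open>The private edges of \<open>A\<close> lie in the top \<open>insert x A\<close>, which
  also absorbs the common neighbours containing \<open>x\<close>. The others must contain every
  \<open>y\<close> that arises from an exchange at \<open>B\<close>: either they fit into a top at
  \<open>B\<close>, or there are none.\<close>

lemma coverable_not_star:
  assumes "\<not> star k (priv E A B)"
    and e: "e0 \<in> priv E A B" "\<not> A \<inter> B \<subseteq> e0" and f: "f0 \<in> priv E B A" "\<not> A \<inter> B \<subseteq> f0"
  shows "coverable (k - 1) (2 * ((k + 2) div 2)) E"
proof (cases "common E A B = {}")
  case True
  interpret sw: independent_pair k E B A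
    by (rule swap)
  show ?thesis
    using coverable_Un[OF coverable_priv sw.coverable_priv] E_split True by (simp add: mult_2)
next
  case False
  interpret sw: independent_pair k E B A
    by (rule swap)
  obtain a1 a2 where a: "a1 \<noteq> a2" "A - B = {a1, a2}"
    using common_diff False by blast
  have AB: "a1 \<in> A" "a2 \<in> A" "a1 \<notin> B" "a2 \<notin> B"
    using a(2) by blast+
  have AB_cases: "u = a1 \<or> u = a2" if "u \<in> A" "u \<notin> B" for u
    using that a(2) by blast
  obtain x where x: "x \<notin> A" "\<And>e. e \<in> priv E A B \<Longrightarrow> e \<subseteq> insert x A"
    using priv_top assms(1) by blast
  have priv_eq: "e = insert x (A - {s})" if "e \<in> priv E A B" "s \<in> A" "s \<notin> e" for e s
  proof -
    have "e \<in> E" "adj e A" "e \<noteq> A"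
      using that unfolding priv_def by auto
    then obtain a x' where "a \<in> A" "x' \<notin> A" "e = insert x' (A - {a})"
      by (rule exchange_A)
    then show ?thesis
      using that x(2)[OF that(1)] by auto
  qed
  \<comment> \<open>It suffices to find an edge \<open>insert x (A - {a})\<close>,
    \<open>a \<in> A \<inter> B\<close>, not adjacent to \<open>insert y (B - {b})\<close>: by
    \<open>no_three\<close>, \<open>Z\<close> is adjacent to one of the two, and
    \<open>common_adj_exchanged\<close> applies.\<close>
  have key: "x \<in> Z \<or> y \<in> Z"
    if Z: "Z \<in> common E A B" and fE: "insert y (B - {b}) \<in> E" and b: "b \<in> A \<inter> B" and y: "y \<notin> B" for Z y b
  proof -
    have "\<exists>e a. e \<in> E \<and> a \<in> A \<inter> B \<and> e = insert x (A - {a}) \<and> \<not> adj e (insert y (B - {b}))"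
    proof (cases "x \<in> B")
      case True
      have "finite (A - {b})" "card (A - {b}) = k - 1"
        using sets[OF A] b by auto
      \<comment> \<open>Here \<open>x\<close> also lies in \<open>insert y (B - {b})\<close>, so
        \<open>b\<close> must serve as a witness of non-adjacency; hence an edge missing some
        \<open>s \<noteq> b\<close> is taken.\<close>
      then obtain e where e: "e \<in> priv E A B" "\<not> A - {b} \<subseteq> e"
        using assms(1) unfolding star_def by blast
      then obtain s where s: "s \<in> A" "s \<noteq> b" "s \<notin> e"
        by blast
      have eq: "e = insert x (A - {s})"
        using priv_eq e s by blast
      have "\<not> adj e B"
        using e unfolding priv_def by blast
      \<comment> \<open>As \<open>x \<in> B\<close>, the two points of \<open>e\<close> outside
        \<open>B\<close> come from \<open>A\<close>. They exhaust \<open>A - B\<close>, so the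
        removed \<open>s\<close> lies in \<open>B\<close>, and one of them differs from
        \<open>y\<close>.\<close>
      then obtain u v where uv: "u \<in> A - B" "v \<in> A - B" "u \<noteq> v" "u \<noteq> s" "v \<noteq> s"
        unfolding adj_def eq using True by auto
      then have "s \<in> B"
        using AB_cases s by (metis DiffD1 DiffD2)
      moreover obtain c where "c \<in> A - B" "c \<noteq> y" "c \<noteq> s"
        using uv by metis
      then have "\<not> adj e (insert y (B - {b}))"
        using b y s unfolding eq by (intro not_adjI[of b _ _ c]) auto
      ultimately show ?thesis
        using e eq s unfolding priv_def by blast
    next
      case False
      obtain s where s: "s \<in> A" "s \<in> B" "s \<notin> e0"
        using e by blast
      have eq: "e0 = insert x (A - {s})"
        using priv_eq e s by blast
      have "\<not> adj e0 (insert y (B - {b}))"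
      \<comment> \<open>If \<open>y \<in> A\<close>, then \<open>x \<noteq> y\<close>, and
        \<open>x\<close> with a point of \<open>A - B\<close> other than \<open>y\<close> witnesses
        non-adjacency; otherwise both points of \<open>A - B\<close> do.\<close>
      proof (cases "y \<in> A")
        case True
        obtain c where "c \<in> A" "c \<notin> B" "c \<noteq> y"
          using AB a(1) by metis
        then show ?thesis
          using True False x(1) s unfolding eq by (intro not_adjI[of x _ _ c]) auto
      next
        case False
        then show ?thesis
          using AB a(1) s unfolding eq by (intro not_adjI[of a1 _ _ a2]) auto
      qed
      then show ?thesis
        using e eq s unfolding priv_def by blast
    qed
    then obtain e a where *: "e \<in> E" "a \<in> A \<inter> B" "e = insert x (A - {a})" "\<not> adj e (insert y (B - {b}))"
      by blast
    have "Z \<in> E"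
      using Z unfolding common_def by blast
    then consider "adj e Z" | "adj (insert y (B - {b})) Z"
      using no_three * fE by blast
    then show ?thesis
    proof cases
      case 1
      then show ?thesis
        using common_adj_exchanged Z x(1) * by blast
    next
      case 2
      then show ?thesis
        using sw.common_adj_exchanged[of Z y b] Z y b by (auto simp: common_commute[of E A B])
    qed
  qed
  have top_A: "coverable (k - 1) ((k + 2) div 2) (priv E A B \<union> {Z \<in> common E A B. x \<in> Z})"
  proof (rule coverable_top_A[OF _ x(1)])
    fix e assume "e \<in> priv E A B \<union> {Z \<in> common E A B. x \<in> Z}"
    \<comment> \<open>A common neighbour containing \<open>x\<close> has no second point outside
      \<open>A\<close>.\<close>
    then show "e \<subseteq> insert x A"
      using x adjD[of e A x] unfolding common_def by blast
  qed (auto simp: priv_def common_def)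
  obtain b where b: "b \<in> A" "b \<in> B" "b \<notin> f0"
    using f by blast
  have f0: "f0 \<in> E" "adj f0 B" "f0 \<noteq> B"
    using f b unfolding priv_def by auto
  then obtain y where y: "y \<notin> B" "f0 = insert y (B - {b})"
    using sw.exchange_A b by (metis insertI2 insert_Diff insert_iff)
  show ?thesis
  proof (cases "\<forall>f\<in>priv E B A. f \<subseteq> insert y B")
    case True
    have "coverable (k - 1) ((k + 2) div 2) (priv E B A \<union> {Z \<in> common E A B. y \<in> Z})"
    proof (rule sw.coverable_top_A[OF _ y(1)])
      fix e assume "e \<in> priv E B A \<union> {Z \<in> common E A B. y \<in> Z}"
      then show "e \<subseteq> insert y B"
        using y(1) True adjD[of e B y] unfolding common_def by blast
    qed (auto simp: priv_def common_def)
    from coverable_Un[OF top_A this] show ?thesis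
    proof (rule coverable_mono)
      have "x \<in> Z \<or> y \<in> Z" if "Z \<in> common E A B" for Z
        using key that f0(1) b y by blast
      then show "E \<subseteq> priv E A B \<union> {Z \<in> common E A B. x \<in> Z} \<union>
          (priv E B A \<union> {Z \<in> common E A B. y \<in> Z})"
        using E_split by blast
    qed simp
  next
    case False
    then obtain f1 where f1: "f1 \<in> priv E B A" "\<not> f1 \<subseteq> insert y B"
      by blast
    \<comment> \<open>A top at \<open>B\<close> containing \<open>f0\<close> could only be
      \<open>insert y B\<close>, which \<open>f1\<close> leaves.\<close>
    have "star k (priv E B A)"
    proof (rule ccontr)
      assume "\<not> star k (priv E B A)"
      then obtain z where z: "\<And>g. g \<in> priv E B A \<Longrightarrow> g \<subseteq> insert z B"
        using sw.priv_top by blast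
      then have "z = y"
        using z[OF f(1)] y by blast
      with z f1 show False by blast
    qed
    then obtain c where c: "finite c" "card c = k - 1" "\<And>g. g \<in> priv E B A \<Longrightarrow> c \<subseteq> g"
      unfolding star_def by blast
    have "c \<subseteq> B - {b}"
      using c(3)[OF f(1)] c(3)[OF sw.A_in_priv] b by blast
    then have "c = B - {b}"
      using c sets[OF B] b by (intro card_subset_eq) auto
    have "f1 \<in> E" "adj f1 B" "f1 \<noteq> B"
      using f1 unfolding priv_def by auto
    then obtain b' y' where f1_eq: "b' \<in> B" "y' \<notin> B" "f1 = insert y' (B - {b'})"
      by (rule sw.exchange_A)
    have "b' = b"
      using c(3)[OF f1(1)] \<open>c = B - {b}\<close> f1_eq by blast
    have "y' \<noteq> y"
      using f1 f1_eq by blast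
    \<comment> \<open>Both \<open>f0\<close> and \<open>f1\<close> arise by removing
      \<open>b\<close>, with different new points \<open>y\<close> and \<open>y'\<close>. Avoiding
      \<open>x\<close> would force both into \<open>Z\<close>, two points outside
      \<open>B\<close>.\<close>
    have "x \<in> Z" if Z: "Z \<in> common E A B" for Z
    proof (rule ccontr)
      assume "x \<notin> Z"
      then have "y \<in> Z" "y' \<in> Z"
        using key[OF Z, of y b] key[OF Z, of y' b] f0(1) \<open>f1 \<in> E\<close> b y f1_eq \<open>b' = b\<close> by auto
      then show False
        using Z adjD[of Z B y y'] y(1) f1_eq(2) \<open>y' \<noteq> y\<close> unfolding common_def by blast
    qed
    then have "E \<subseteq> priv E A B \<union> {Z \<in> common E A B. x \<in> Z} \<union> priv E B A"
      using E_split by blast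
    with coverable_Un[OF top_A sw.coverable_priv] show ?thesis
      using coverable_mono by (metis mult_2 order_refl)
  qed
qed

lemma coverable_E: "coverable (k - 1) (2 * ((k + 2) div 2)) E"
proof -
  interpret sw: independent_pair k E B A
    by (rule swap)
  \<comment> \<open>With q = \<open>(k + 2) div 2\<close>, this makes both 2 + q and the four sets
    of the \<open>stars\<close> case fit into 2 q.\<close>
  have q: "(k + 2) div 2 \<ge> 2"
    using k by simp
  consider (none) "common E A B = {}"
    | (A) "common E A B \<noteq> {}" "\<forall>e\<in>priv E A B. A \<inter> B \<subseteq> e"
    | (B) "common E A B \<noteq> {}" "\<forall>f\<in>priv E B A. A \<inter> B \<subseteq> f"
    | (stars) "common E A B \<noteq> {}" "star k (priv E A B)" "star k (priv E B A)"
    | (not_star) e f where "e \<in> priv E A B" "\<not> A \<inter> B \<subseteq> e" "f \<in> priv E B A" "\<not> A \<inter> B \<subseteq> f"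
        "\<not> star k (priv E A B) \<or> \<not> star k (priv E B A)"
    by blast
  then show ?thesis
  proof cases
    case none
    then show ?thesis
      using coverable_Un[OF coverable_priv sw.coverable_priv] E_split by (simp add: mult_2)
  next
    case A
    then have "coverable (k - 1) 2 (common E A B \<union> priv E A B)"
      by (intro coverable_common_Un) auto
    from coverable_Un[OF this sw.coverable_priv] show ?thesis
      by (rule coverable_mono) (use q E_split in auto)
  next
    case B
    then have "coverable (k - 1) 2 (common E B A \<union> priv E B A)"
      by (intro sw.coverable_common_Un) (auto simp: common_commute[of E A B])
    from coverable_Un[OF this coverable_priv] show ?thesis
      by (rule coverable_mono) (use q E_split common_commute[of E A B] in auto)
  next
    case stars
    have "coverable (k - 1) 2 (common E A B \<union> {})"
      using stars by (intro coverable_common_Un) auto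
    from coverable_Un[OF this coverable_Un[OF coverable_star[OF stars(2)] coverable_star[OF stars(3)]]]
    show ?thesis
      by (rule coverable_mono) (use q E_split in auto)
  next
    \<comment> \<open>By symmetry, the private family that is not a star takes the role of
      \<open>priv E A B\<close>.\<close>
    case (not_star e f)
    then show ?thesis
      using coverable_not_star[of e f] sw.coverable_not_star[of f e] by (auto simp: Int_commute)
  qed
qed

end

section \<open>Covers of hypergraphs\<close>

lemma cover_number_le:
  assumes "finite_uniform_hypergraph k V E" "m \<le> k" "coverable m n E"
  shows "cover_number m V E \<le> n"
proof -
  obtain C where C: "finite C" "card C \<le> n" "\<forall>c\<in>C. finite c \<and> card c = m" "\<forall>e\<in>E. \<exists>c\<in>C. c \<subseteq> e"
    using assms(3) unfolding coverable_def by blast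
  \<comment> \<open>Cover sets not inside \<open>V\<close> lie in no edge and can be
    discarded.\<close>
  define D where "D = {c \<in> C. c \<subseteq> V}"
  have "\<exists>c\<in>D. c \<subseteq> e" if e: "e \<in> E" for e
  proof -
    have "e \<subseteq> V"
      using e assms(1) unfolding finite_uniform_hypergraph_def nsets_def by blast
    obtain c where "c \<in> C" "c \<subseteq> e"
      using C(4) e by blast
    then show ?thesis
      using \<open>e \<subseteq> V\<close> unfolding D_def by blast
  qed
  then have "is_cover m V E D"
    using C(3) by (auto simp: is_cover_def D_def nsets_def)
  then have "cover_number m V E \<le> card D"
    unfolding cover_number_def using cover_number_attained(1)[OF assms(1,2)] by (intro Min_le) auto
  also have "card D \<le> card C"
    unfolding D_def using C by (intro card_mono) auto
  finally show ?thesis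
    using C by simp
qed

theorem theorem1:
  fixes k :: nat and V :: "'a set" and E :: "'a set set"
  assumes "k \<ge> 3"
    and "finite_uniform_hypergraph k V E"
    and "matching_number (k - 1) E = 2"
  shows "int (cover_number (k - 1) V E) \<le> 2 * \<lceil>(real k + 1) / 2\<rceil>"
proof -
  let ?S = "{card M | M. is_matching (k - 1) E M}"
  have sets: "finite e \<and> card e = k" if "e \<in> E" for e
    using that assms(2) unfolding finite_uniform_hypergraph_def nsets_def by blast
  have nadj: "\<not> adj e f \<longleftrightarrow> card (e \<inter> f) < k - 1" if "e \<in> E" for e f
    using not_adj_iff_card_Int[of e k f] sets[OF that] assms(1) by auto
  have le2: "card M \<le> 2" if "is_matching (k - 1) E M" for M
    using Max_ge[OF matching_number_attained(1)[OF assms(2), of "k - 1"]] that assms(3)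
    unfolding matching_number_def by auto
  have "2 \<in> ?S"
    using Max_in[OF matching_number_attained[OF assms(2), of "k - 1"]] assms(3)
    unfolding matching_number_def by simp
  then obtain M where M: "is_matching (k - 1) E M" "card M = 2"
    by auto
  then obtain A B where AB: "M = {A, B}" "A \<noteq> B"
    by (auto simp: card_2_iff)
  have inE: "A \<in> E" "B \<in> E" and "card (A \<inter> B) < k - 1"
    using M(1) AB by (auto simp: is_matching_def pairwise_def)
  then have "\<not> adj A B"
    using nadj by blast
  have no_three: "adj e f \<or> adj e g \<or> adj f g" if "e \<in> E" "f \<in> E" "g \<in> E" for e f g
  proof (rule ccontr)
    assume n: "\<not> (adj e f \<or> adj e g \<or> adj f g)"
    then have "e \<noteq> f" "e \<noteq> g" "f \<noteq> g"
      using adj_refl by blast+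
    moreover have "is_matching (k - 1) E {e, f, g}"
      using n that nadj by (auto simp: is_matching_def pairwise_def Int_commute)
    ultimately show False
      using le2[of "{e, f, g}"] by simp
  qed
  interpret independent_pair k E A B
    using assms(1) sets inE \<open>\<not> adj A B\<close> no_three by unfold_locales blast+
  have "cover_number (k - 1) V E \<le> 2 * ((k + 2) div 2)"
    using cover_number_le[OF assms(2) _ coverable_E] by simp
  moreover have "\<lceil>(real k + 1) / 2\<rceil> = int ((k + 2) div 2)"
    by (cases "even k") (auto elim!: evenE oddE simp: ceiling_eq_iff field_simps)
  ultimately show ?thesis
    by linarith
qed

end
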